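(* For all integers $n \geqslant 2$, the number of pairwise non-isomorphic even graphs on $n$ vertices is equal to the number of pairwise non-isomorphic tournaments on $n$ vertices.
   Context: Graphs are finite, simple and undirected. Let $X$ be a graph and assign an arbitrary orientation to its edges. An automorphism $g \in \mathrm{Aut}(X)$ (of the undirected graph $X$; it need not respect the orientation) reverses the sense of an edge $e=\{u,v\}$ if $e$ is oriented from $u$ to $v$ but the edge $e^g = \{u^g,v^g\}$ is oriented from $v^g$ to $u^g$. It is known that the parity of the number of edges whose sense is reversed by $g$ does not depend on the chosen orientation. The graph $X$ is called odd if it has an automorphism reversing the sense of an odd number of edges, and even otherwise. (When the vertex set is $[n]=\{1,\dots,n\}$ one may use the orientation in which each edge goes from its lower- to its higher-numbered vertex.) A tournament is a directed graph $D$ (without loops) with arc set $A(D)$ such that for any two distinct vertices $v,w$, either $(v,w)\in A(D)$ or $(w,v)\in A(D)$, but not both. Counting pairwise non-isomorphic objects means counting isomorphism classes. *)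

theory Defs
  imports "Graph_Theory.Graph_Theory" "HOL-Combinatorics.Permutations"
begin

text \<open>
  Finite simple undirected graphs are the symmetric loop-free finite digraphs
  \<^locale>\<open>pair_graph\<close>: the edge \<open>{u,v}\<close> is represented by the two arcs
  \<open>(u,v)\<close> and \<open>(v,u)\<close>. For digraphs without parallel arcs,
  \<^const>\<open>digraph_iso\<close> amounts to a bijection of the vertices that preserves and reflects arcs
  (lemma \<open>digraph_iso_with_proj_iff\<close> below).
\<close>

definition orientation :: "'a pair_pre_digraph \<Rightarrow> 'a rel \<Rightarrow> bool" where
  "orientation X D \<longleftrightarrow> D \<subseteq> parcs X \<and> (\<forall>(u,v) \<in> parcs X. (u,v) \<in> D \<longleftrightarrow> (v,u) \<notin> D)"

definition automorphism :: "'a pair_pre_digraph \<Rightarrow> ('a \<Rightarrow> 'a) \<Rightarrow> bool" where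
  "automorphism X g \<longleftrightarrow>
     g permutes pverts X \<and>
     (\<forall>u \<in> pverts X. \<forall>v \<in> pverts X. (u,v) \<in> parcs X \<longleftrightarrow> (g u, g v) \<in> parcs X)"

definition reversed_edges :: "'a rel \<Rightarrow> ('a \<Rightarrow> 'a) \<Rightarrow> 'a set set" where
  "reversed_edges D g = {{u,v} | u v. (u,v) \<in> D \<and> (g v, g u) \<in> D}"

text \<open>
  Quantifying the orientation existentially is only one way of fixing an arbitrary orientation:
  by lemma \<open>odd_graph_iff\<close> below, any single orientation yields the same notion.
\<close>

definition odd_graph :: "'a pair_pre_digraph \<Rightarrow> bool" where
  "odd_graph X \<longleftrightarrow> pair_graph X \<and>
     (\<exists>D g. orientation X D \<and> automorphism X g \<and> odd (card (reversed_edges D g)))"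

definition even_graph :: "'a pair_pre_digraph \<Rightarrow> bool" where
  "even_graph X \<longleftrightarrow> pair_graph X \<and> \<not> odd_graph X"

definition tournament :: "'a pair_pre_digraph \<Rightarrow> bool" where
  "tournament T \<longleftrightarrow> pair_digraph T \<and>
     (\<forall>v \<in> pverts T. \<forall>w \<in> pverts T. v \<noteq> w \<longrightarrow> ((v,w) \<in> parcs T \<longleftrightarrow> (w,v) \<notin> parcs T))"

definition iso_classes :: "'a pair_pre_digraph set \<Rightarrow> 'a pair_pre_digraph set set" where
  "iso_classes A = A // {(G,H). G \<in> A \<and> H \<in> A \<and> digraph_iso (with_proj G) (with_proj H)}"


subsection \<open>Independence of the orientation\<close>

lemma orientation_less:
  fixes X :: "'a :: linorder pair_pre_digraph"
  assumes "pair_graph X"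
  shows "orientation X {(u,v) \<in> parcs X. u < v}"
proof -
  interpret pair_graph X by fact
  have "(v,u) \<in> parcs X \<and> u \<noteq> v" if "(u,v) \<in> parcs X" for u v
    using that pair_sym_arcs pair_no_loops[OF that] by (auto simp: symmetric_def dest: symD)
  then show ?thesis
    unfolding orientation_def by force
qed

lemma even_card_sym_diff:
  assumes "finite A" "finite B"
  shows "even (card (sym_diff A B)) \<longleftrightarrow> (even (card A) \<longleftrightarrow> even (card B))"
proof -
  have a: "card A = card (A - B) + card (A \<inter> B)"
    using assms by (metis add.commute card_Int_Diff)
  have b: "card B = card (B - A) + card (A \<inter> B)"
    using assms by (metis Int_commute add.commute card_Int_Diff)
  have "card (sym_diff A B) = card (A - B) + card (B - A)"
    using assms by (intro card_Un_disjoint) auto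
  with a b show ?thesis by presburger
qed

lemma odd_reversed_edges_independent:
  assumes X: "pair_graph X" and D: "orientation X D" and D': "orientation X D'"
    and g: "automorphism X g"
  shows "odd (card (reversed_edges D g)) \<longleftrightarrow> odd (card (reversed_edges D' g))"
proof -
  interpret pair_graph X by fact
  have sym: "(v,u) \<in> parcs X" if "(u,v) \<in> parcs X" for u v
    using that pair_sym_arcs by (auto simp: symmetric_def dest: symD)
  have d: "D \<subseteq> parcs X" "\<And>u v. (u,v) \<in> parcs X \<Longrightarrow> (u,v) \<in> D \<longleftrightarrow> (v,u) \<notin> D"
    and d': "D' \<subseteq> parcs X" "\<And>u v. (u,v) \<in> parcs X \<Longrightarrow> (u,v) \<in> D' \<longleftrightarrow> (v,u) \<notin> D'"
    using D D' by (auto simp: orientation_def)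
  have perm: "g permutes pverts X" using g by (simp add: automorphism_def)
  have inj: "inj g" using perm by (rule permutes_inj)
  have arc: "(g u, g v) \<in> parcs X \<longleftrightarrow> (u,v) \<in> parcs X" for u v
  proof
    assume "(u,v) \<in> parcs X"
    then show "(g u, g v) \<in> parcs X"
      using g in_arcsD1 in_arcsD2 unfolding automorphism_def by blast
  next
    assume a: "(g u, g v) \<in> parcs X"
    then have "u \<in> pverts X" "v \<in> pverts X"
      using in_arcsD1[OF a] in_arcsD2[OF a] permutes_in_image[OF perm] by auto
    then show "(u,v) \<in> parcs X" using g a unfolding automorphism_def by blast
  qed
  define E where "E = (\<lambda>(u,v). {u,v}) ` parcs X"
  define F where "F = {{u,v} | u v. (u,v) \<in> D \<and> (v,u) \<in> D'}"
  define F' where "F' = {e \<in> E. g ` e \<in> F}"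
  have finE: "finite E" unfolding E_def using pair_finite_arcs by simp
  have E_iff: "{u,v} \<in> E \<longleftrightarrow> (u,v) \<in> parcs X" for u v
    unfolding E_def using sym by (force simp: doubleton_eq_iff)
  have R_sub: "reversed_edges D g \<subseteq> E" "reversed_edges D' g \<subseteq> E" "F \<subseteq> E" "F' \<subseteq> E"
    using d(1) d'(1) E_iff unfolding reversed_edges_def F_def F'_def by blast+
  note fin = R_sub[THEN finite_subset[OF _ finE]]
  have rev: "{u,v} \<in> reversed_edges D g \<longleftrightarrow> ((u,v) \<in> D \<longleftrightarrow> (g v, g u) \<in> D)"
    and rev': "{u,v} \<in> reversed_edges D' g \<longleftrightarrow> ((u,v) \<in> D' \<longleftrightarrow> (g v, g u) \<in> D')"
    and F: "{u,v} \<in> F \<longleftrightarrow> \<not> ((u,v) \<in> D \<longleftrightarrow> (u,v) \<in> D')"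
    if "(u,v) \<in> parcs X" for u v
    using that sym[OF that] d(2)[of u v] d'(2)[of u v] d(2)[of "g u" "g v"] d'(2)[of "g u" "g v"]
      arc[of u v]
    unfolding reversed_edges_def F_def by (auto simp: doubleton_eq_iff)
  have F': "{u,v} \<in> F' \<longleftrightarrow> \<not> ((g u, g v) \<in> D \<longleftrightarrow> (g u, g v) \<in> D')"
    if "(u,v) \<in> parcs X" for u v
    using that F[of "g u" "g v"] arc[of u v] E_iff[of u v] by (simp add: F'_def)
  have "(`) g ` F' = F"
  proof (intro equalityI subsetI)
    fix e assume e: "e \<in> F"
    then obtain u v where uv: "e = {u,v}" "(u,v) \<in> parcs X"
      using d(1) unfolding F_def by blast
    obtain u' v' where "u = g u'" "v = g v'"
      using permutes_surj[OF perm] by (metis surjD)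
    with uv e show "e \<in> (`) g ` F'"
      unfolding F'_def using arc E_iff by (intro image_eqI[of _ _ "{u',v'}"]) auto
  qed (auto simp: F'_def)
  then have cardF: "card F' = card F"
    using card_image[of "(`) g" F'] inj by (simp add: inj_on_def inj_image_eq_iff)
  have "e \<in> reversed_edges D' g \<longleftrightarrow> e \<in> sym_diff (reversed_edges D g) (sym_diff F F')" for e
  proof (cases "e \<in> E")
    case True
    then obtain u v where uv: "e = {u,v}" "(u,v) \<in> parcs X"
      unfolding E_def by auto
    show ?thesis
      using rev[OF uv(2)] rev'[OF uv(2)] F[OF uv(2)] F'[OF uv(2)]
        d(2)[of "g u" "g v"] d'(2)[of "g u" "g v"] arc[of u v] uv
      unfolding uv(1) Un_iff Diff_iff by argo
  next
    case False
    then show ?thesis using R_sub by blast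
  qed
  then have "reversed_edges D' g = sym_diff (reversed_edges D g) (sym_diff F F')" by blast
  then show ?thesis
    using fin cardF by (simp add: even_card_sym_diff)
qed

lemma odd_graph_iff:
  assumes "pair_graph X" "orientation X D"
  shows "odd_graph X \<longleftrightarrow> (\<exists>g. automorphism X g \<and> odd (card (reversed_edges D g)))"
  using assms odd_reversed_edges_independent unfolding odd_graph_def by blast


subsection \<open>Isomorphism\<close>

lemma digraph_iso_with_proj_iff:
  assumes "pair_wf_digraph G" "pair_wf_digraph H"
  shows "digraph_iso (with_proj G) (with_proj H) \<longleftrightarrow>
    (\<exists>f. bij_betw f (pverts G) (pverts H) \<and>
      (\<forall>u \<in> pverts G. \<forall>v \<in> pverts G. (u,v) \<in> parcs G \<longleftrightarrow> (f u, f v) \<in> parcs H))"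
    (is "?L \<longleftrightarrow> ?R")
proof
  interpret G: pair_wf_digraph G by fact
  interpret H: pair_wf_digraph H by fact
  {
    assume ?L
    then obtain h where h: "pre_digraph.digraph_isomorphism (with_proj G) h"
      and H: "with_proj H = app_iso h (with_proj G)"
      unfolding digraph_iso_def by blast
    let ?f = "iso_verts h"
    have inj: "inj_on ?f (pverts G)" and
      V: "pverts H = ?f ` pverts G" and A: "parcs H = iso_arcs h ` parcs G"
      and t: "iso_tail h = fst" "iso_head h = snd"
      using h H unfolding pre_digraph.digraph_isomorphism_def app_iso_def with_proj_def by auto
    have arcs: "iso_arcs h a = (?f (fst a), ?f (snd a))" if "a \<in> parcs G" for a
      using h that t unfolding pre_digraph.digraph_isomorphism_def
      by (auto simp: prod_eq_iff)
    have A': "parcs H = (\<lambda>a. (?f (fst a), ?f (snd a))) ` parcs G"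
      unfolding A using arcs by (intro image_cong) auto
    have "(u,v) \<in> parcs G \<longleftrightarrow> (?f u, ?f v) \<in> parcs H" if "u \<in> pverts G" "v \<in> pverts G" for u v
    proof
      assume "(?f u, ?f v) \<in> parcs H"
      then obtain x y where "(x,y) \<in> parcs G" "?f u = ?f x" "?f v = ?f y"
        unfolding A' by auto
      then show "(u,v) \<in> parcs G"
        using that inj G.in_arcsD1 G.in_arcsD2 by (metis inj_onD)
    qed (force simp: A')
    then show ?R
      using inj V by (intro exI[of _ ?f]) (simp add: bij_betw_def)
  next
    assume ?R
    then obtain f where f: "bij_betw f (pverts G) (pverts H)"
      and A: "\<And>u v. u \<in> pverts G \<Longrightarrow> v \<in> pverts G \<Longrightarrow>
        (u,v) \<in> parcs G \<longleftrightarrow> (f u, f v) \<in> parcs H"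
      by blast
    let ?h = "\<lparr>iso_verts = f, iso_arcs = map_prod f f, iso_head = snd, iso_tail = fst\<rparr>"
    have inj: "inj_on f (pverts G)" and V: "pverts H = f ` pverts G"
      using f by (auto simp: bij_betw_def)
    have sub: "parcs G \<subseteq> pverts G \<times> pverts G"
      using G.in_arcsD1 G.in_arcsD2 by auto
    have "inj_on (map_prod f f) (parcs G)"
      using map_prod_inj_on[OF inj inj] sub by (rule inj_on_subset)
    moreover have "parcs H = map_prod f f ` parcs G"
    proof (intro equalityI subsetI)
      fix a assume a: "a \<in> parcs H"
      then have "fst a \<in> f ` pverts G" "snd a \<in> f ` pverts G"
        using H.arc_fst_in_verts H.arc_snd_in_verts V by auto
      then obtain u v where "u \<in> pverts G" "v \<in> pverts G" "a = (f u, f v)"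
        by (metis imageE prod.collapse)
      then show "a \<in> map_prod f f ` parcs G" using a A by force
    next
      fix a assume "a \<in> map_prod f f ` parcs G"
      then obtain u v where "(u,v) \<in> parcs G" "a = (f u, f v)" by auto
      then show "a \<in> parcs H" using A[of u v] G.in_arcsD1[of u v] G.in_arcsD2[of u v] by simp
    qed
    ultimately show ?L
      unfolding digraph_iso_def pre_digraph.digraph_isomorphism_def app_iso_def
      using inj V G.wf_digraph_axioms by (intro exI[of _ ?h]) (auto simp: with_proj_def)
  }
qed

end

theory Submission
  imports Defs
begin

text \<open>
  For a permutation \<open>g\<close> of the vertices, a graph \<open>X\<close> and a tournament \<open>T\<close>, let \<open>sign(X,T,g)\<close>
  be \<open>-1\<close> to the number of edges of \<open>X\<close> whose orientation in \<open>T\<close> is reversed by \<open>g\<close>, whether or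
  not \<open>g\<close> is an automorphism of \<open>X\<close>. Sum this sign over all triples \<open>(X,T,g)\<close> in two ways.
  For fixed \<open>T\<close> and \<open>g\<close>, toggling in \<open>X\<close> an edge reversed by \<open>g\<close> changes the sign, so the sum over
  \<open>X\<close> is the number of graphs if \<open>g\<close> fixes \<open>T\<close> and \<open>0\<close> otherwise. For fixed \<open>X\<close> and \<open>g\<close> with
  \<open>g\<close> not an automorphism, there is a pair \<open>e\<close> such that exactly one of \<open>e\<close> and its image \<open>g(e)\<close>
  is an edge; reversing the arc \<open>g(e)\<close> of \<open>T\<close> changes the sign, so the sum over \<open>T\<close> vanishes. On
  the automorphism group of \<open>X\<close> the sign is a homomorphism, which sums to the order of the group
  if \<open>X\<close> is even and to \<open>0\<close> if \<open>X\<close> is odd. As there are as many graphs as tournaments, the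
  orders of the automorphism groups have the same sum over all even graphs as over all
  tournaments, and orbit counting turns both sums into numbers of isomorphism classes.
\<close>

section \<open>Labelled structures, toggling of pairs, and the reversal sign\<close>

definition relabel :: "('a \<Rightarrow> 'a) \<Rightarrow> 'a pair_pre_digraph \<Rightarrow> 'a pair_pre_digraph" where
  "relabel g X = \<lparr>pverts = g ` pverts X, parcs = map_prod g g ` parcs X\<rparr>"

definition stabilizer :: "'a set \<Rightarrow> 'a pair_pre_digraph \<Rightarrow> ('a \<Rightarrow> 'a) set" where
  "stabilizer V X = {g. g permutes V \<and> relabel g X = X}"

definition graphs_on :: "'a set \<Rightarrow> 'a pair_pre_digraph set" where
  "graphs_on V = {X. pair_graph X \<and> pverts X = V}"

definition tournaments_on :: "'a set \<Rightarrow> 'a pair_pre_digraph set" where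
  "tournaments_on V = {T. tournament T \<and> pverts T = V}"

definition edges :: "'a pair_pre_digraph \<Rightarrow> 'a set set" where
  "edges X = (\<lambda>(u,v). {u,v}) ` parcs X"

text \<open>One operation serves both kinds of object: in a graph it adds or deletes the edge
  between \<open>u\<close> and \<open>v\<close>; in a tournament, where exactly one of the two arcs
  is present, it reverses that arc.\<close>

definition flip :: "'a \<Rightarrow> 'a \<Rightarrow> 'a pair_pre_digraph \<Rightarrow> 'a pair_pre_digraph" where
  "flip u v X = \<lparr>pverts = pverts X, parcs = sym_diff (parcs X) {(u,v), (v,u)}\<rparr>"

text \<open>A tournament orients all pairs of vertices at once, hence every graph on these vertices,
  so \<open>X\<close> and \<open>T\<close> can vary independently in a double sum.\<close>

definition reversal_sign ::
    "'a pair_pre_digraph \<Rightarrow> 'a pair_pre_digraph \<Rightarrow> ('a \<Rightarrow> 'a) \<Rightarrow> int" where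
  "reversal_sign X T g = (-1) ^ card (edges X \<inter> reversed_edges (parcs T) g)"

subsection \<open>Relabelling\<close>

lemma relabel_id [simp]: "relabel id X = X"
  by (simp add: relabel_def map_prod.id)

lemma relabel_comp: "relabel (g \<circ> h) X = relabel g (relabel h X)"
  by (simp add: relabel_def image_comp map_prod.comp)

lemma relabel_inv:
  assumes "bij g"
  shows "relabel (inv g) (relabel g X) = X" "relabel g (relabel (inv g) X) = X"
  using assms surj_iff[of g] by (simp_all flip: relabel_comp add: bij_is_inj bij_is_surj)

lemma pverts_relabel: "g permutes pverts X \<Longrightarrow> pverts (relabel g X) = pverts X"
  by (simp add: relabel_def permutes_image)

lemma parcs_relabel_iff:
  assumes "inj g"
  shows "(g u, g v) \<in> parcs (relabel g X) \<longleftrightarrow> (u,v) \<in> parcs X"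
  using assms by (auto simp: relabel_def inj_eq)

text \<open>Each arc of \<open>Y\<close> has the form \<open>(g u, g v)\<close> since
  \<open>g\<close> maps onto \<open>V\<close>, so equality can be tested pair by pair. The case
  \<open>Y = X\<close> describes automorphisms, the general case isomorphisms.\<close>

lemma relabel_eq_iff:
  assumes "g permutes V" "pverts X = V" "pverts Y = V" "parcs X \<subseteq> V \<times> V" "parcs Y \<subseteq> V \<times> V"
  shows "relabel g X = Y \<longleftrightarrow> (\<forall>u\<in>V. \<forall>v\<in>V. (u,v) \<in> parcs X \<longleftrightarrow> (g u, g v) \<in> parcs Y)"
    (is "_ \<longleftrightarrow> ?R")
proof
  assume "relabel g X = Y"
  then show ?R using parcs_relabel_iff[of g] permutes_inj[OF assms(1)] by blast
next
  assume R: ?R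
  have "parcs (relabel g X) = parcs Y"
  proof (intro equalityI subrelI)
    fix x y assume "(x,y) \<in> parcs (relabel g X)"
    then show "(x,y) \<in> parcs Y" using R assms(4) by (auto simp: relabel_def)
  next
    fix x y assume a: "(x,y) \<in> parcs Y"
    with assms(5) have "x \<in> g ` V" "y \<in> g ` V"
      by (auto simp: permutes_image[OF assms(1)])
    then obtain u v where "u \<in> V" "v \<in> V" "x = g u" "y = g v" by auto
    with a R show "(x,y) \<in> parcs (relabel g X)" by (force simp: relabel_def)
  qed
  then show "relabel g X = Y"
    using assms by (simp add: relabel_def permutes_image)
qed

text \<open>For fixed \<open>X\<close>, the permutations taking \<open>X\<close> to \<open>Y\<close> form a coset of the
  stabilizer, so each class contributes exactly \<open>fact (card V)\<close> to the sum.\<close>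

lemma card_classes_relabel:
  fixes A :: "'a pair_pre_digraph set"
  assumes V: "finite V" and A: "finite A"
    and closed: "\<And>g X. g permutes V \<Longrightarrow> X \<in> A \<Longrightarrow> relabel g X \<in> A"
  shows "(\<Sum>X\<in>A. card (stabilizer V X)) =
    fact (card V) * card (A // {(X,Y). X \<in> A \<and> Y \<in> A \<and> (\<exists>g. g permutes V \<and> relabel g X = Y)})"
proof -
  let ?r = "{(X,Y). X \<in> A \<and> Y \<in> A \<and> (\<exists>g. g permutes V \<and> relabel g X = Y)}"
  have equiv: "equiv A ?r"
  proof (rule equivI)
    show "?r \<subseteq> A \<times> A" by auto
    show "refl_on A ?r" by (auto simp: refl_on_def intro!: exI[of _ id] permutes_id)
    show "sym ?r"
    proof (rule symI, clarify)
      fix X g assume "X \<in> A" "relabel g X \<in> A" "g permutes V"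
      then show "\<exists>h. h permutes V \<and> relabel h (relabel g X) = X"
        by (intro exI[of _ "inv g"]) (simp add: relabel_inv permutes_bij permutes_inv)
    qed
    show "trans ?r"
    proof (rule transI, clarify)
      fix X g h assume "g permutes V" "h permutes V"
      then show "\<exists>k. k permutes V \<and> relabel k X = relabel h (relabel g X)"
        by (intro exI[of _ "h \<circ> g"]) (simp add: relabel_comp permutes_compose)
    qed
  qed
  have class_sum: "(\<Sum>X\<in>C. card (stabilizer V X)) = fact (card V)" if C: "C \<in> A // ?r" for C
  proof -
    \<comment> \<open>Closure of \<open>A\<close> makes the class the full orbit of \<open>X\<close>
      under the permutations of \<open>V\<close>.\<close>
    obtain X where X: "X \<in> A" and CX: "C = {Y. \<exists>g. g permutes V \<and> relabel g X = Y}"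
      using C closed by (auto elim!: quotientE)
    have finC: "finite C"
      using C equiv A by (meson finite_subset in_quotient_imp_subset)
    have "card (stabilizer V Y) = card {g. g permutes V \<and> relabel g X = Y}" if Y: "Y \<in> C" for Y
    proof -
      obtain k where k: "k permutes V" "relabel k X = Y" using Y CX by auto
      have "bij_betw (\<lambda>h. h \<circ> k) (stabilizer V Y) {g. g permutes V \<and> relabel g X = Y}"
      proof (rule bij_betw_byWitness[where f' = "\<lambda>g. g \<circ> inv k"])
        show "\<forall>h\<in>stabilizer V Y. h \<circ> k \<circ> inv k = h"
          by (simp add: comp_assoc permutes_inv_o[OF k(1)])
        show "\<forall>g\<in>{g. g permutes V \<and> relabel g X = Y}. g \<circ> inv k \<circ> k = g"
          by (simp add: comp_assoc permutes_inv_o[OF k(1)])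
        show "(\<lambda>h. h \<circ> k) ` stabilizer V Y \<subseteq> {g. g permutes V \<and> relabel g X = Y}"
          using k by (auto simp: stabilizer_def relabel_comp permutes_compose)
        show "(\<lambda>g. g \<circ> inv k) ` {g. g permutes V \<and> relabel g X = Y} \<subseteq> stabilizer V Y"
          using k by (auto simp: stabilizer_def relabel_comp permutes_compose permutes_inv
              relabel_inv permutes_bij)
      qed
      then show ?thesis by (rule bij_betw_same_card)
    qed
    then have "(\<Sum>Y\<in>C. card (stabilizer V Y)) = (\<Sum>Y\<in>C. card {g. g permutes V \<and> relabel g X = Y})"
      by simp
    \<comment> \<open>Every permutation takes \<open>X\<close> to exactly one member of
      \<open>C\<close>, so these sets partition the permutations of \<open>V\<close>.\<close>
    also have "\<dots> = card (\<Union>Y\<in>C. {g. g permutes V \<and> relabel g X = Y})"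
      using finC finite_permutations[OF V] by (subst card_UN_disjoint) auto
    also have "(\<Union>Y\<in>C. {g. g permutes V \<and> relabel g X = Y}) = {g. g permutes V}"
      using CX by auto
    finally show ?thesis using card_permutations[OF refl V] by simp
  qed
  have "(\<Sum>X\<in>A. card (stabilizer V X)) = (\<Sum>X\<in>\<Union>(A // ?r). card (stabilizer V X))"
    using Union_quotient[OF equiv] by simp
  also have "\<dots> = (\<Sum>C\<in>A // ?r. \<Sum>X\<in>C. card (stabilizer V X))"
  proof (subst sum.Union_disjoint)
    show "\<forall>C\<in>A // ?r. finite C"
      using in_quotient_imp_subset[OF equiv] A finite_subset by blast
    show "\<forall>C\<in>A // ?r. \<forall>D\<in>A // ?r. C \<noteq> D \<longrightarrow> C \<inter> D = {}"
      using quotient_disj[OF equiv] by blast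
  qed simp
  also have "\<dots> = fact (card V) * card (A // ?r)"
    using class_sum by simp
  finally show ?thesis .
qed

subsection \<open>Graphs and tournaments\<close>

lemma mem_graphs_on_iff:
  assumes "finite V"
  shows "X \<in> graphs_on V \<longleftrightarrow>
    pverts X = V \<and> parcs X \<subseteq> V \<times> V \<and> irrefl (parcs X) \<and> sym (parcs X)"
    (is "_ \<longleftrightarrow> ?R")
proof
  assume "X \<in> graphs_on V"
  then have "pair_graph X" and V: "pverts X = V" by (auto simp: graphs_on_def)
  then interpret pair_graph X by simp
  have "parcs X \<subseteq> pverts X \<times> pverts X" using in_arcsD1 in_arcsD2 by auto
  moreover have "irrefl (parcs X)" using pair_no_loops by (force simp: irrefl_def)
  ultimately show ?R using V pair_sym_arcs by (simp add: symmetric_def)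
next
  assume R: ?R
  then have "pair_graph X"
    using assms finite_subset[of "parcs X" "V \<times> V"]
    by unfold_locales (auto simp: symmetric_def irrefl_def)
  with R show "X \<in> graphs_on V" by (simp add: graphs_on_def)
qed

lemma mem_tournaments_on_iff:
  assumes "finite V"
  shows "T \<in> tournaments_on V \<longleftrightarrow>
    pverts T = V \<and> parcs T \<subseteq> V \<times> V \<and> asym (parcs T) \<and> total_on V (parcs T)"
    (is "_ \<longleftrightarrow> ?R")
proof
  assume T: "T \<in> tournaments_on V"
  then have "pair_digraph T" by (auto simp: tournaments_on_def tournament_def)
  then interpret pair_digraph T by simp
  have sub: "parcs T \<subseteq> V \<times> V" and irr: "\<And>u v. (u,v) \<in> parcs T \<Longrightarrow> u \<noteq> v"
    using in_arcsD1 in_arcsD2 pair_no_loops T by (force simp: tournaments_on_def)+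
  have "(v,u) \<notin> parcs T" if "(u,v) \<in> parcs T" for u v
    using T that sub irr[OF that] unfolding tournaments_on_def tournament_def by blast
  then have "asym (parcs T)" by (rule asymI)
  moreover have "total_on V (parcs T)"
    using T unfolding tournaments_on_def tournament_def total_on_def by blast
  ultimately show ?R using T sub by (simp add: tournaments_on_def)
next
  assume R: ?R
  then have sub: "parcs T \<subseteq> V \<times> V" "pverts T = V" and asym: "asym (parcs T)" by blast+
  then have "pair_digraph T"
    using assms finite_subset[of "parcs T" "V \<times> V"]
    by unfold_locales (auto dest: asymD)
  with R show "T \<in> tournaments_on V"
    unfolding tournaments_on_def tournament_def total_on_def by (blast dest: asymD)
qed

lemma finite_digraphs_on:
  assumes "finite V"
  shows "finite {X :: 'a pair_pre_digraph. pverts X = V \<and> parcs X \<subseteq> V \<times> V}"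
    (is "finite ?A")
proof (rule finite_subset)
  show "?A \<subseteq> (\<lambda>D. \<lparr>pverts = V, parcs = D\<rparr>) ` Pow (V \<times> V)"
  proof
    fix X assume "X \<in> ?A"
    then show "X \<in> (\<lambda>D. \<lparr>pverts = V, parcs = D\<rparr>) ` Pow (V \<times> V)"
      by (intro image_eqI[of _ _ "parcs X"]) auto
  qed
qed (intro finite_imageI finite_Pow_iff[THEN iffD2] finite_cartesian_product assms)

lemma finite_graphs_on: "finite V \<Longrightarrow> finite (graphs_on V)"
  by (rule finite_subset[OF _ finite_digraphs_on[of V]]) (auto simp: mem_graphs_on_iff)

lemma finite_tournaments_on: "finite V \<Longrightarrow> finite (tournaments_on V)"
  by (rule finite_subset[OF _ finite_digraphs_on[of V]]) (auto simp: mem_tournaments_on_iff)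

lemma relabel_graphs_on:
  assumes V: "finite V" and g: "g permutes V" and X: "X \<in> graphs_on V"
  shows "relabel g X \<in> graphs_on V"
proof -
  have X': "pverts X = V" "parcs X \<subseteq> V \<times> V" "irrefl (parcs X)" "sym (parcs X)"
    using X by (auto simp: mem_graphs_on_iff[OF V])
  have "parcs (relabel g X) \<subseteq> V \<times> V"
    using X'(2) permutes_in_image[OF g] by (auto simp: relabel_def)
  moreover have "irrefl (parcs (relabel g X))"
    using X'(3) permutes_inj[OF g] by (auto simp: relabel_def irrefl_def inj_eq)
  moreover have "sym (parcs (relabel g X))"
    using X'(4) by (force simp: relabel_def sym_def)
  ultimately show ?thesis
    using X'(1) pverts_relabel[of g X] g by (simp add: mem_graphs_on_iff[OF V])
qed

lemma relabel_tournaments_on: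
  assumes V: "finite V" and g: "g permutes V" and T: "T \<in> tournaments_on V"
  shows "relabel g T \<in> tournaments_on V"
proof -
  have T': "pverts T = V" "parcs T \<subseteq> V \<times> V" "asym (parcs T)" "total_on V (parcs T)"
    using T by (auto simp: mem_tournaments_on_iff[OF V])
  have inj: "inj g" by (rule permutes_inj[OF g])
  have "parcs (relabel g T) \<subseteq> V \<times> V"
    using T'(2) permutes_in_image[OF g] by (auto simp: relabel_def)
  moreover have "asym (parcs (relabel g T))"
    using inj by (auto intro!: asymI simp: relabel_def inj_eq dest: asymD[OF T'(3)])
  moreover have "total_on V (parcs (relabel g T))"
  proof (rule total_onI)
    fix x y assume "x \<in> V" "y \<in> V" "x \<noteq> y"
    moreover from this obtain u v where "u \<in> V" "v \<in> V" "x = g u" "y = g v"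
      using permutes_image[OF g] by (metis imageE)
    ultimately show "(x,y) \<in> parcs (relabel g T) \<or> (y,x) \<in> parcs (relabel g T)"
      using T'(4) by (auto simp: parcs_relabel_iff[OF inj] total_on_def)
  qed
  ultimately show ?thesis
    using T'(1) pverts_relabel[of g T] g by (simp add: mem_tournaments_on_iff[OF V])
qed

lemma flip_flip: "flip u v (flip u v X) = X"
  by (cases X) (auto simp: flip_def)

lemma flip_graphs_on:
  assumes "finite V" "u \<in> V" "v \<in> V" "u \<noteq> v" "X \<in> graphs_on V"
  shows "flip u v X \<in> graphs_on V"
  using assms by (auto simp: mem_graphs_on_iff flip_def irrefl_def sym_def)

lemma flip_tournaments_on:
  assumes V: "finite V" and uv: "u \<in> V" "v \<in> V" "u \<noteq> v" and T: "T \<in> tournaments_on V"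
  shows "flip u v T \<in> tournaments_on V"
proof -
  have T': "pverts T = V" "parcs T \<subseteq> V \<times> V" "asym (parcs T)" "total_on V (parcs T)"
    using T by (auto simp: mem_tournaments_on_iff[OF V])
  have uv': "(u,v) \<in> parcs T \<longleftrightarrow> (v,u) \<notin> parcs T"
    using T'(3,4) uv by (auto simp: total_on_def dest: asymD)
  have "asym (parcs (flip u v T))"
    by (rule asymI) (use asymD[OF T'(3)] uv' uv in \<open>auto simp: flip_def\<close>)
  moreover have "total_on V (parcs (flip u v T))"
    by (rule total_onI) (use T'(4) uv' in \<open>auto simp: flip_def total_on_def\<close>)
  moreover have "parcs (flip u v T) \<subseteq> V \<times> V" using T'(2) uv by (auto simp: flip_def)
  ultimately show ?thesis using T'(1) by (simp add: mem_tournaments_on_iff[OF V] flip_def)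
qed

text \<open>The linear order gives every pair a reference direction: an edge corresponds to an
  upward arc, a non-edge to a downward one. The map \<open>t\<close> keeps the upward off-diagonal
  pairs of the relation and complements the downward ones, hence undoes itself.\<close>

lemma card_graphs_on_eq_card_tournaments_on:
  fixes V :: "'a :: linorder set"
  assumes V: "finite V"
  shows "card (graphs_on V) = card (tournaments_on V)"
proof -
  \<comment> \<open>The same formula turns graphs into tournaments and back.\<close>
  define t where "t X = \<lparr>pverts = V,
      parcs = {(u,v) \<in> V \<times> V. u \<noteq> v \<and> ((u,v) \<in> parcs X \<longleftrightarrow> u < v)}\<rparr>"
    for X :: "'a pair_pre_digraph"
  have t_t: "t (t X) = X" if "pverts X = V" "parcs X \<subseteq> V \<times> V" "irrefl (parcs X)" for X
    using that by (cases X) (auto simp: t_def irrefl_def)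
  have "bij_betw t (graphs_on V) (tournaments_on V)"
  proof (rule bij_betw_byWitness[where f' = t])
    show "\<forall>X\<in>graphs_on V. t (t X) = X"
      by (simp add: mem_graphs_on_iff[OF V] t_t)
    show "\<forall>T\<in>tournaments_on V. t (t T) = T"
      by (auto simp: mem_tournaments_on_iff[OF V] irrefl_def dest: asymD intro!: t_t)
    show "t ` graphs_on V \<subseteq> tournaments_on V"
    proof (rule image_subsetI)
      fix X assume "X \<in> graphs_on V"
      then have "(u,v) \<in> parcs X \<longleftrightarrow> (v,u) \<in> parcs X" for u v
        by (auto simp: mem_graphs_on_iff[OF V] dest: symD)
      then have "asym (parcs (t X))" "total_on V (parcs (t X))"
        by (auto simp: t_def total_on_def intro!: asymI)
      then show "t X \<in> tournaments_on V"
        by (auto simp: mem_tournaments_on_iff[OF V] t_def)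
    qed
    show "t ` tournaments_on V \<subseteq> graphs_on V"
    proof (rule image_subsetI)
      fix T assume "T \<in> tournaments_on V"
      then have "\<And>u v. (u,v) \<in> parcs T \<Longrightarrow> (v,u) \<notin> parcs T"
        "\<And>u v. u \<in> V \<Longrightarrow> v \<in> V \<Longrightarrow> u \<noteq> v \<Longrightarrow> (u,v) \<in> parcs T \<or> (v,u) \<in> parcs T"
        by (auto simp: mem_tournaments_on_iff[OF V] total_on_def dest: asymD)
      then have "sym (parcs (t T))"
        by (intro symI) (auto simp: t_def)
      then show "t T \<in> graphs_on V"
        by (auto simp: mem_graphs_on_iff[OF V] t_def irrefl_def)
    qed
  qed
  then show ?thesis by (rule bij_betw_same_card)
qed

subsection \<open>Isomorphism classes\<close>

lemma digraph_iso_iff_relabel: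
  assumes "pverts X = V" "pverts Y = V" "parcs X \<subseteq> V \<times> V" "parcs Y \<subseteq> V \<times> V"
  shows "digraph_iso (with_proj X) (with_proj Y) \<longleftrightarrow> (\<exists>g. g permutes V \<and> relabel g X = Y)"
proof -
  have "pair_wf_digraph X" "pair_wf_digraph Y"
    using assms by (unfold_locales; auto)+
  note * = digraph_iso_with_proj_iff[OF this, unfolded assms(1,2)]
  show ?thesis
    unfolding *
  proof (intro iffI; elim exE conjE)
    fix f assume f: "bij_betw f V V"
      "\<forall>u\<in>V. \<forall>v\<in>V. (u,v) \<in> parcs X \<longleftrightarrow> (f u, f v) \<in> parcs Y"
    \<comment> \<open>The isomorphism \<open>f\<close> may take any values outside \<open>V\<close>.
      Resetting it to the identity there gives a permutation with the same effect on arcs.\<close>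
    have "restrict_id f V permutes V"
      using f(1) by (intro bij_imp_permutes) (auto cong: bij_betw_cong)
    moreover have "relabel (restrict_id f V) X = Y"
      using f(2) relabel_eq_iff[OF calculation assms] by simp
    ultimately show "\<exists>g. g permutes V \<and> relabel g X = Y" by blast
  next
    fix g assume g: "g permutes V" "relabel g X = Y"
    show "\<exists>f. bij_betw f V V \<and>
        (\<forall>u\<in>V. \<forall>v\<in>V. (u,v) \<in> parcs X \<longleftrightarrow> (f u, f v) \<in> parcs Y)"
      using g(2) permutes_imp_bij[OF g(1)] unfolding relabel_eq_iff[OF g(1) assms] by blast
  qed
qed

text \<open>On a fixed vertex set, isomorphism is the orbit relation of relabelling, so the orbit
  count applies. It is needed twice, for even graphs and for tournaments.\<close>

lemma card_iso_classes:
  fixes A :: "'a pair_pre_digraph set"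
  assumes "finite V" and sub: "\<And>X. X \<in> A \<Longrightarrow> pverts X = V \<and> parcs X \<subseteq> V \<times> V"
    and closed: "\<And>g X. g permutes V \<Longrightarrow> X \<in> A \<Longrightarrow> relabel g X \<in> A"
  shows "fact (card V) * card (iso_classes A) = (\<Sum>X\<in>A. card (stabilizer V X))"
proof -
  have "finite A"
    by (rule finite_subset[OF _ finite_digraphs_on[OF assms(1)]]) (use sub in auto)
  moreover have "{(X,Y). X \<in> A \<and> Y \<in> A \<and> digraph_iso (with_proj X) (with_proj Y)} =
      {(X,Y). X \<in> A \<and> Y \<in> A \<and> (\<exists>g. g permutes V \<and> relabel g X = Y)}"
    by (rule Collect_cong) (simp add: case_prod_beta sub digraph_iso_iff_relabel[of _ V] cong: conj_cong)
  ultimately show ?thesis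
    using card_classes_relabel[OF assms(1) _ closed] unfolding iso_classes_def by simp
qed

subsection \<open>Signs of permutations on graphs\<close>

lemma mem_edges_iff:
  assumes "finite V" "X \<in> graphs_on V"
  shows "{u,v} \<in> edges X \<longleftrightarrow> (u,v) \<in> parcs X"
  using assms by (force simp: edges_def mem_graphs_on_iff doubleton_eq_iff dest: symD)

lemma finite_edges:
  assumes "finite V" "X \<in> graphs_on V"
  shows "finite (edges X)"
  using assms finite_subset[of "parcs X" "V \<times> V"] by (simp add: edges_def mem_graphs_on_iff)

lemma tournament_arc_iff:
  assumes "finite V" "T \<in> tournaments_on V" "u \<in> V" "v \<in> V" "u \<noteq> v"
  shows "(v,u) \<in> parcs T \<longleftrightarrow> (u,v) \<notin> parcs T"
  using assms by (auto simp: mem_tournaments_on_iff total_on_def dest: asymD)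

text \<open>Reversal becomes a Boolean difference between the directions of a pair and of its image,
  so later claims about symmetric differences reduce to propositional identities.\<close>

lemma reversed_edges_tournament_iff:
  assumes V: "finite V" and T: "T \<in> tournaments_on V" and g: "g permutes V"
    and uv: "u \<in> V" "v \<in> V" "u \<noteq> v"
  shows "{u,v} \<in> reversed_edges (parcs T) g \<longleftrightarrow> ((u,v) \<in> parcs T \<longleftrightarrow> (g u, g v) \<notin> parcs T)"
proof -
  have "g u \<in> V" "g v \<in> V" "g u \<noteq> g v"
    using uv permutes_in_image[OF g] permutes_inj[OF g] by (auto simp: inj_eq)
  note g_arc = tournament_arc_iff[OF V T this]
  have "{u,v} \<in> reversed_edges (parcs T) g \<longleftrightarrow>
      (u,v) \<in> parcs T \<and> (g v, g u) \<in> parcs T \<or> (v,u) \<in> parcs T \<and> (g u, g v) \<in> parcs T"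
    unfolding reversed_edges_def by (auto simp: doubleton_eq_iff)
  then show ?thesis using g_arc tournament_arc_iff[OF V T uv] by argo
qed

lemma reversed_edges_tournamentE:
  assumes "finite V" "T \<in> tournaments_on V" "e \<in> reversed_edges (parcs T) g"
  obtains u v where "e = {u,v}" "u \<in> V" "v \<in> V" "u \<noteq> v"
proof -
  obtain u v where "e = {u,v}" "(u,v) \<in> parcs T"
    using assms(3) unfolding reversed_edges_def by blast
  moreover from this have "u \<in> V" "v \<in> V" "u \<noteq> v"
    using assms(1,2) by (auto simp: mem_tournaments_on_iff dest: asymD)
  ultimately show thesis using that by blast
qed

section \<open>Cancellation by sign-reversing involutions\<close>

lemma minus_one_power_card_sym_diff:
  assumes "finite A" "finite B"
  shows "(-1 :: int) ^ card (sym_diff A B) = (-1) ^ card A * (-1) ^ card B"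
  using even_card_sym_diff[OF assms] by (simp add: minus_one_power_iff)

text \<open>Reindexing by the involution negates the sum, and an integer equal to its negative is
  0.\<close>

lemma sum_eq_0_if_sign_reversing_involution:
  fixes f :: "'b \<Rightarrow> int"
  assumes "\<And>x. x \<in> A \<Longrightarrow> i x \<in> A" "\<And>x. x \<in> A \<Longrightarrow> i (i x) = x"
    and neg: "\<And>x. x \<in> A \<Longrightarrow> f (i x) = - f x"
  shows "sum f A = 0"
proof -
  have "sum f A = (\<Sum>x\<in>A. f (i x))"
    by (rule sum.reindex_bij_witness[where i = i and j = i]) (use assms(1,2) in auto)
  also have "\<dots> = - sum f A" by (simp add: neg sum_negf)
  finally show ?thesis by simp
qed

text \<open>Supplies the pair to be toggled. Its vertices are distinct because a loop is an arc
  neither before nor after applying \<open>g\<close>.\<close>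

lemma relabel_neqE:
  assumes "g permutes V" "pverts X = V" "parcs X \<subseteq> V \<times> V" "irrefl (parcs X)" "relabel g X \<noteq> X"
  obtains u v where "u \<in> V" "v \<in> V" "u \<noteq> v" "(u,v) \<in> parcs X \<longleftrightarrow> (g u, g v) \<notin> parcs X"
proof -
  obtain u v where uv: "u \<in> V" "v \<in> V" "(u,v) \<in> parcs X \<longleftrightarrow> (g u, g v) \<notin> parcs X"
    using assms(5) unfolding relabel_eq_iff[OF assms(1,2,2,3,3)] by blast
  with assms(4) have "u \<noteq> v" by (auto simp: irrefl_def)
  with uv show thesis using that by blast
qed

text \<open>The set of reversed pairs depends on \<open>T\<close> and \<open>g\<close> only, so
  toggling one of its members in \<open>X\<close> changes its intersection with
  \<open>edges X\<close> by exactly one element.\<close>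

lemma sum_reversal_sign_graphs:
  assumes V: "finite V" and g: "g permutes V" and T: "T \<in> tournaments_on V"
  shows "(\<Sum>X\<in>graphs_on V. reversal_sign X T g) =
    (if relabel g T = T then int (card (graphs_on V)) else 0)"
proof (cases "relabel g T = T")
  case True
  \<comment> \<open>An automorphism of \<open>T\<close> that reversed an arc would force both
    directions of the same pair into \<open>T\<close>.\<close>
  have "reversed_edges (parcs T) g = {}"
  proof (rule ccontr)
    assume "reversed_edges (parcs T) g \<noteq> {}"
    then obtain u v where "(u,v) \<in> parcs T" "(g v, g u) \<in> parcs T"
      unfolding reversed_edges_def by blast
    moreover from this have "(v,u) \<in> parcs T"
      using parcs_relabel_iff[OF permutes_inj[OF g], of v u T] True by simp
    ultimately show False using T by (auto simp: mem_tournaments_on_iff[OF V] dest: asymD)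
  qed
  then show ?thesis using True by (simp add: reversal_sign_def)
next
  case False
  let ?R = "reversed_edges (parcs T) g"
  have "pverts T = V" "parcs T \<subseteq> V \<times> V" "irrefl (parcs T)"
    using T by (auto simp: mem_tournaments_on_iff[OF V] irrefl_def dest: asymD)
  then obtain u v where uv: "u \<in> V" "v \<in> V" "u \<noteq> v"
    and "(u,v) \<in> parcs T \<longleftrightarrow> (g u, g v) \<notin> parcs T"
    using relabel_neqE[OF g _ _ _ False] by metis
  then have e: "{u,v} \<in> ?R"
    by (simp add: reversed_edges_tournament_iff[OF V T g uv])
  have "(\<Sum>X\<in>graphs_on V. reversal_sign X T g) = 0"
  proof (rule sum_eq_0_if_sign_reversing_involution[where i = "flip u v"])
    fix X assume X: "X \<in> graphs_on V"
    show fX: "flip u v X \<in> graphs_on V" by (rule flip_graphs_on[OF V uv X])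
    show "flip u v (flip u v X) = X" by (rule flip_flip)
    have "d \<in> edges (flip u v X) \<longleftrightarrow> d \<in> sym_diff (edges X) {{u,v}}" for d
    proof (cases "\<exists>x y. d = {x,y}")
      case True
      then obtain x y where d: "d = {x,y}" by blast
      show ?thesis
        unfolding d using mem_edges_iff[OF V X, of x y] mem_edges_iff[OF V fX, of x y]
        by (auto simp: flip_def doubleton_eq_iff)
    qed (auto simp: edges_def)
    then have eq: "edges (flip u v X) \<inter> ?R = sym_diff (edges X \<inter> ?R) {{u,v}}"
      using e by blast
    show "reversal_sign (flip u v X) T g = - reversal_sign X T g"
      using finite_edges[OF V X] unfolding reversal_sign_def eq
      by (subst minus_one_power_card_sym_diff) simp_all
  qed
  then show ?thesis using False by simp
qed

text \<open>Flipping \<open>T\<close> on \<open>{g a, g b}\<close> changes the reversal status of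
  just two pairs: \<open>{g a, g b}\<close> itself and \<open>{a, b}\<close>, whose image it is.
  Exactly one of them is an edge of \<open>X\<close>, so the sign changes.\<close>

lemma sum_reversal_sign_tournaments:
  assumes V: "finite V" and g: "g permutes V" and X: "X \<in> graphs_on V"
    and neq: "relabel g X \<noteq> X"
  shows "(\<Sum>T\<in>tournaments_on V. reversal_sign X T g) = 0"
proof -
  have inj: "inj g" by (rule permutes_inj[OF g])
  have X': "pverts X = V" "parcs X \<subseteq> V \<times> V" "irrefl (parcs X)" "sym (parcs X)"
    using X by (auto simp: mem_graphs_on_iff[OF V])
  obtain a b where ab: "a \<in> V" "b \<in> V" "a \<noteq> b"
    and diff: "(a,b) \<in> parcs X \<longleftrightarrow> (g a, g b) \<notin> parcs X"
    using relabel_neqE[OF g X'(1-3) neq] by metis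
  have gab: "g a \<in> V" "g b \<in> V" "g a \<noteq> g b"
    using ab permutes_in_image[OF g] inj by (auto simp: inj_eq)
  let ?a = "{a,b}" and ?b = "{g a, g b}"
  have diff': "?a \<in> edges X \<longleftrightarrow> ?b \<notin> edges X"
    using diff by (simp add: mem_edges_iff[OF V X])
  \<comment> \<open>Were the two pairs equal, the two changes of status would cancel.\<close>
  then have neq': "?a \<noteq> ?b" by metis
  show ?thesis
  proof (rule sum_eq_0_if_sign_reversing_involution[where i = "flip (g a) (g b)"])
    fix T assume T: "T \<in> tournaments_on V"
    let ?T = "flip (g a) (g b) T"
    show fT: "?T \<in> tournaments_on V" by (rule flip_tournaments_on[OF V gab T])
    show "flip (g a) (g b) ?T = T" by (rule flip_flip)
    have flip_iff: "(u,v) \<in> parcs ?T \<longleftrightarrow> ((u,v) \<in> parcs T \<longleftrightarrow> {u,v} \<noteq> ?b)" for u v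
      by (auto simp: flip_def doubleton_eq_iff)
    have "d \<in> reversed_edges (parcs ?T) g \<longleftrightarrow>
        d \<in> sym_diff (reversed_edges (parcs T) g) {?a, ?b}" for d
    proof (cases "\<exists>u v. d = {u,v} \<and> u \<in> V \<and> v \<in> V \<and> u \<noteq> v")
      case True
      then obtain u v where d: "d = {u,v}" and uv: "u \<in> V" "v \<in> V" "u \<noteq> v" by blast
      have "{g u, g v} = ?b \<longleftrightarrow> {u,v} = ?a"
        using inj by (auto simp: doubleton_eq_iff inj_eq)
      then show ?thesis
        using neq' unfolding d Un_iff Diff_iff insert_iff empty_iff
          reversed_edges_tournament_iff[OF V T g uv] reversed_edges_tournament_iff[OF V fT g uv] flip_iff
        by metis
    next
      case False
      then show ?thesis
        using reversed_edges_tournamentE[OF V T, of d g] reversed_edges_tournamentE[OF V fT, of d g]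
          ab gab by blast
    qed
    then have eq: "edges X \<inter> reversed_edges (parcs ?T) g =
        sym_diff (edges X \<inter> reversed_edges (parcs T) g) (edges X \<inter> {?a, ?b})"
      by blast
    have "card (edges X \<inter> {?a, ?b}) = 1"
      using diff' by (cases "?a \<in> edges X") simp_all
    then show "reversal_sign X ?T g = - reversal_sign X T g"
      using finite_edges[OF V X] unfolding reversal_sign_def eq
      by (subst minus_one_power_card_sym_diff) simp_all
  qed
qed

section \<open>The sign as a character of the automorphism group\<close>

lemma automorphism_iff_stabilizer:
  assumes "finite V" "X \<in> graphs_on V"
  shows "automorphism X g \<longleftrightarrow> g \<in> stabilizer V X"
proof -
  have "pverts X = V" "parcs X \<subseteq> V \<times> V"
    using assms by (auto simp: mem_graphs_on_iff)
  then show ?thesis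
    using relabel_eq_iff[of g V X X] by (auto simp: automorphism_def stabilizer_def)
qed

lemma stabilizer_arc_iff:
  assumes "g \<in> stabilizer V X"
  shows "(g u, g v) \<in> parcs X \<longleftrightarrow> (u,v) \<in> parcs X"
  using assms parcs_relabel_iff[of g u v X] permutes_inj[of g V] by (simp add: stabilizer_def)

text \<open>The product reverses \<open>e\<close> iff exactly one of the following holds:
  \<open>g\<close> reverses \<open>e\<close>, or \<open>h\<close> reverses the image of
  \<open>e\<close> under \<open>g\<close>. As \<open>g\<close> permutes the edges of
  \<open>X\<close>, the edges of the second type are as many as the edges reversed by
  \<open>h\<close>.\<close>

lemma reversal_sign_mult:
  assumes V: "finite V" and X: "X \<in> graphs_on V" and T: "T \<in> tournaments_on V"
    and g: "g \<in> stabilizer V X" and h: "h \<in> stabilizer V X"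
  shows "reversal_sign X T (h \<circ> g) = reversal_sign X T h * reversal_sign X T g"
proof -
  have gV: "g permutes V" and hV: "h permutes V" using g h by (auto simp: stabilizer_def)
  have inj: "inj g" by (rule permutes_inj[OF gV])
  have X': "parcs X \<subseteq> V \<times> V" "irrefl (parcs X)"
    using X by (auto simp: mem_graphs_on_iff[OF V])
  let ?R = "reversed_edges (parcs T)"
  define F where "F = {e \<in> edges X. g ` e \<in> ?R h}"
  have iff: "e \<in> ?R (h \<circ> g) \<longleftrightarrow> e \<in> sym_diff (?R g) F" if e: "e \<in> edges X" for e
  proof -
    obtain u v where d: "e = {u,v}" and "(u,v) \<in> parcs X"
      using e by (auto simp: edges_def)
    with X' have uv: "u \<in> V" "v \<in> V" "u \<noteq> v" by (auto simp: irrefl_def)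
    then have guv: "g u \<in> V" "g v \<in> V" "g u \<noteq> g v"
      using permutes_in_image[OF gV] inj by (auto simp: inj_eq)
    have "e \<in> F \<longleftrightarrow> {g u, g v} \<in> ?R h" using e by (simp add: F_def d)
    then show ?thesis
      using reversed_edges_tournament_iff[OF V T hV guv]
        reversed_edges_tournament_iff[OF V T gV uv]
        reversed_edges_tournament_iff[OF V T permutes_compose[OF gV hV] uv]
      unfolding d Un_iff Diff_iff comp_apply by argo
  qed
  have eq: "edges X \<inter> ?R (h \<circ> g) = sym_diff (edges X \<inter> ?R g) F"
    using iff unfolding F_def by blast
  have "(`) g ` F = edges X \<inter> ?R h"
  proof (intro equalityI subsetI)
    fix e assume "e \<in> (`) g ` F"
    then obtain u v where "(u,v) \<in> parcs X" "e = {g u, g v}" "e \<in> ?R h"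
      by (auto simp: F_def edges_def)
    then show "e \<in> edges X \<inter> ?R h"
      using mem_edges_iff[OF V X] stabilizer_arc_iff[OF g] by simp
  next
    fix e assume e: "e \<in> edges X \<inter> ?R h"
    then obtain x y where "(x,y) \<in> parcs X" "e = {x,y}" by (auto simp: edges_def)
    moreover obtain u v where "x = g u" "y = g v"
      using permutes_surj[OF gV] by (metis surjD)
    ultimately have "{u,v} \<in> F" "e = g ` {u,v}"
      using e mem_edges_iff[OF V X] stabilizer_arc_iff[OF g] by (simp_all add: F_def)
    then show "e \<in> (`) g ` F" by blast
  qed
  moreover have "inj_on ((`) g) F"
    using inj by (simp add: inj_on_def inj_image_eq_iff)
  ultimately have "card F = card (edges X \<inter> ?R h)"
    by (metis card_image)
  moreover have "finite (edges X)" "finite F"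
    using finite_edges[OF V X] by (simp_all add: F_def)
  ultimately show ?thesis
    unfolding reversal_sign_def eq by (simp add: minus_one_power_card_sym_diff)
qed

text \<open>Restricting \<open>T\<close> to the edges of \<open>X\<close> gives an orientation, and
  oddness can be tested on any single one. Since automorphisms map edges to edges, the restriction
  reverses the same edges as \<open>T\<close> does.\<close>

lemma odd_graph_iff_reversal_sign:
  assumes V: "finite V" and X: "X \<in> graphs_on V" and T: "T \<in> tournaments_on V"
  shows "odd_graph X \<longleftrightarrow> (\<exists>g\<in>stabilizer V X. reversal_sign X T g = -1)"
proof -
  let ?D = "parcs X \<inter> parcs T"
  have X': "parcs X \<subseteq> V \<times> V" "irrefl (parcs X)" "sym (parcs X)"
    using X by (auto simp: mem_graphs_on_iff[OF V])
  have "(u,v) \<in> ?D \<longleftrightarrow> (v,u) \<notin> ?D" if uv: "(u,v) \<in> parcs X" for u v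
  proof -
    have "u \<in> V" "v \<in> V" "u \<noteq> v" "(v,u) \<in> parcs X"
      using uv X' by (auto simp: irrefl_def dest: symD)
    then show ?thesis using tournament_arc_iff[OF V T] uv by blast
  qed
  then have D: "orientation X ?D" unfolding orientation_def by blast
  have "reversed_edges ?D g = edges X \<inter> reversed_edges (parcs T) g"
    if g: "g \<in> stabilizer V X" for g
  proof (intro equalityI subsetI)
    fix e assume "e \<in> reversed_edges ?D g"
    then show "e \<in> edges X \<inter> reversed_edges (parcs T) g"
      unfolding reversed_edges_def edges_def by force
  next
    fix e assume "e \<in> edges X \<inter> reversed_edges (parcs T) g"
    then obtain u v where e: "e = {u,v}" "{u,v} \<in> edges X" "(u,v) \<in> parcs T" "(g v, g u) \<in> parcs T"
      unfolding reversed_edges_def by blast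
    then have "(u,v) \<in> parcs X" by (simp add: mem_edges_iff[OF V X])
    moreover from this have "(g v, g u) \<in> parcs X"
      using stabilizer_arc_iff[OF g] symD[OF X'(3)] by blast
    ultimately show "e \<in> reversed_edges ?D g"
      using e unfolding reversed_edges_def by blast
  qed
  then have "reversal_sign X T g = -1 \<longleftrightarrow> odd (card (reversed_edges ?D g))"
    if "g \<in> stabilizer V X" for g
    using that by (simp add: reversal_sign_def minus_one_power_iff)
  then show ?thesis
    using odd_graph_iff[OF _ D] X automorphism_iff_stabilizer[OF V X]
    unfolding graphs_on_def by blast
qed

lemma sum_reversal_sign_stabilizer:
  assumes V: "finite V" and X: "X \<in> graphs_on V" and T: "T \<in> tournaments_on V"
  shows "(\<Sum>g\<in>stabilizer V X. reversal_sign X T g) =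
    (if even_graph X then int (card (stabilizer V X)) else 0)"
proof (cases "odd_graph X")
  case True
  then obtain h where h: "h \<in> stabilizer V X" "reversal_sign X T h = -1"
    using odd_graph_iff_reversal_sign[OF V X T] by blast
  then have hV: "h permutes V" "relabel h X = X" by (auto simp: stabilizer_def)
  have "inv h \<in> stabilizer V X"
    using hV relabel_inv(1)[OF permutes_bij[OF hV(1)], of X]
    by (simp add: stabilizer_def permutes_inv)
  have comp: "k \<circ> g \<in> stabilizer V X" if "g \<in> stabilizer V X" "k \<in> stabilizer V X" for g k
    using that by (simp add: stabilizer_def relabel_comp permutes_compose)
  \<comment> \<open>Left multiplication by \<open>h\<close> permutes the group and negates every
    sign.\<close>
  have "(\<Sum>g\<in>stabilizer V X. reversal_sign X T g) =
      (\<Sum>g\<in>stabilizer V X. reversal_sign X T (h \<circ> g))"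
    by (rule sum.reindex_bij_witness[where i = "\<lambda>g. h \<circ> g" and j = "\<lambda>g. inv h \<circ> g"])
      (use comp h \<open>inv h \<in> _\<close> permutes_inv_o[OF hV(1)] in \<open>auto simp flip: comp_assoc\<close>)
  also have "\<dots> = - (\<Sum>g\<in>stabilizer V X. reversal_sign X T g)"
    using h by (simp add: reversal_sign_mult[OF V X T] sum_negf)
  finally show ?thesis using True by (simp add: even_graph_def)
next
  case False
  have "reversal_sign X T g = 1" if "g \<in> stabilizer V X" for g
  proof -
    have "reversal_sign X T g \<noteq> -1"
      using that False odd_graph_iff_reversal_sign[OF V X T] by blast
    then show ?thesis by (auto simp: reversal_sign_def minus_one_power_iff split: if_splits)
  qed
  then show ?thesis using False X by (simp add: even_graph_def graphs_on_def)
qed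

section \<open>Invariance of oddness and evenness under relabelling\<close>

lemma reversal_sign_conjugate:
  assumes g: "bij g"
  shows "reversal_sign (relabel g X) (relabel g T) (g \<circ> k \<circ> inv g) = reversal_sign X T k"
proof -
  have inj: "inj g" using g by (rule bij_is_inj)
  have edges: "edges (relabel g X) = (`) g ` edges X"
    by (simp add: edges_def relabel_def image_image case_prod_beta)
  \<comment> \<open>Transport of structure: renaming vertices by \<open>g\<close> turns
    \<open>k\<close> into its conjugate and carries reversed pairs to reversed pairs.\<close>
  have "reversed_edges (parcs (relabel g T)) (g \<circ> k \<circ> inv g) =
      (`) g ` reversed_edges (parcs T) k" (is "?A = ?B")
  proof (intro equalityI subsetI)
    fix e assume "e \<in> ?A"
    then obtain x y where xy: "e = {x,y}" "(x,y) \<in> parcs (relabel g T)"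
      "((g \<circ> k \<circ> inv g) y, (g \<circ> k \<circ> inv g) x) \<in> parcs (relabel g T)"
      unfolding reversed_edges_def by blast
    obtain u v where uv: "x = g u" "y = g v"
      using bij_is_surj[OF g] by (metis surjD)
    have "(u,v) \<in> parcs T" "(k v, k u) \<in> parcs T" and e: "e = {g u, g v}"
      using xy inj by (simp_all add: uv parcs_relabel_iff)
    then have "{u,v} \<in> reversed_edges (parcs T) k"
      unfolding reversed_edges_def by blast
    then show "e \<in> ?B" by (rule rev_image_eqI) (simp add: e)
  next
    fix e assume "e \<in> ?B"
    then obtain u v where e: "e = {g u, g v}" "(u,v) \<in> parcs T" "(k v, k u) \<in> parcs T"
      unfolding reversed_edges_def by fastforce
    then have "(g u, g v) \<in> parcs (relabel g T)"
      "((g \<circ> k \<circ> inv g) (g v), (g \<circ> k \<circ> inv g) (g u)) \<in> parcs (relabel g T)"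
      using inj by (simp_all add: parcs_relabel_iff)
    with e(1) show "e \<in> ?A" unfolding reversed_edges_def by blast
  qed
  moreover have inj': "inj ((`) g)" using inj by (simp add: inj_on_def inj_image_eq_iff)
  ultimately have "edges (relabel g X) \<inter> reversed_edges (parcs (relabel g T)) (g \<circ> k \<circ> inv g) =
      (`) g ` (edges X \<inter> reversed_edges (parcs T) k)"
    using edges by (simp add: image_Int)
  moreover have "card ((`) g ` (edges X \<inter> reversed_edges (parcs T) k)) =
      card (edges X \<inter> reversed_edges (parcs T) k)"
    by (rule card_image) (rule inj_on_subset[OF inj' subset_UNIV])
  ultimately show ?thesis by (simp add: reversal_sign_def)
qed

text \<open>Oddness can be tested against any tournament, so \<open>T\<close> is moved along with
  \<open>X\<close>: a conjugate of the odd automorphism is then odd with respect to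
  \<open>relabel g T\<close>.\<close>

lemma odd_graph_relabel:
  assumes V: "finite V" and T: "T \<in> tournaments_on V" and X: "X \<in> graphs_on V"
    and g: "g permutes V" and odd: "odd_graph X"
  shows "odd_graph (relabel g X)"
proof -
  note bij = permutes_bij[OF g]
  obtain k where k: "k \<in> stabilizer V X" "reversal_sign X T k = -1"
    using odd odd_graph_iff_reversal_sign[OF V X T] by blast
  have "g \<circ> k \<circ> inv g \<in> stabilizer V (relabel g X)"
    using k(1) g by (simp add: stabilizer_def permutes_compose permutes_inv relabel_comp
        relabel_inv[OF bij])
  then show ?thesis
    using odd_graph_iff_reversal_sign[OF V relabel_graphs_on[OF V g X] relabel_tournaments_on[OF V g T]]
      reversal_sign_conjugate[OF bij, of X T k] k(2) by auto
qed

lemma even_graph_relabel: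
  assumes V: "finite V" and T: "T \<in> tournaments_on V" and X: "X \<in> graphs_on V"
    and g: "g permutes V" and even: "even_graph X"
  shows "even_graph (relabel g X)"
proof -
  have gX: "relabel g X \<in> graphs_on V" by (rule relabel_graphs_on[OF V g X])
  \<comment> \<open>If the relabelled graph were odd, relabelling it back by \<open>inv g\<close>
    would make \<open>X\<close> odd.\<close>
  have "\<not> odd_graph (relabel g X)"
    using odd_graph_relabel[OF V T gX permutes_inv[OF g]] even
    unfolding relabel_inv(1)[OF permutes_bij[OF g]] even_graph_def by blast
  then show ?thesis using gX by (simp add: even_graph_def graphs_on_def)
qed

section \<open>The double count\<close>

theorem card_iso_classes_even_graphs_eq_tournaments:
  fixes V :: "'a :: linorder set"
  assumes V: "finite V"
  shows "card (iso_classes {X. even_graph X \<and> pverts X = V}) =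
         card (iso_classes {T. tournament T \<and> pverts T = V})"
proof -
  let ?P = "{g. g permutes V}"
  let ?G = "graphs_on V" and ?T = "tournaments_on V"
  define E where "E = {X. even_graph X \<and> pverts X = V}"
  have E: "E = {X \<in> ?G. even_graph X}"
    by (auto simp: E_def graphs_on_def even_graph_def)
  note [simp] = finite_permutations[OF V] finite_graphs_on[OF V] finite_tournaments_on[OF V]
  \<comment> \<open>The edgeless graph makes the common number of graphs and tournaments positive.
    This yields a reference tournament \<open>T\<close> for the invariance of evenness and allows
    cancellation at the end.\<close>
  have "\<lparr>pverts = V, parcs = {}\<rparr> \<in> ?G"
    by (simp add: mem_graphs_on_iff[OF V] irrefl_def sym_def)
  then have pos: "card ?G > 0" by (auto simp: card_gt_0_iff)
  then obtain T where T: "T \<in> ?T"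
    by (metis card_graphs_on_eq_card_tournaments_on[OF V] card_gt_0_iff ex_in_conv)
  have E_count: "fact (card V) * card (iso_classes E) = (\<Sum>X\<in>E. card (stabilizer V X))"
  proof (rule card_iso_classes[OF V])
    show "relabel g X \<in> E" if "g permutes V" "X \<in> E" for g X
      using that relabel_graphs_on[OF V] even_graph_relabel[OF V T] unfolding E by blast
  qed (simp_all add: E mem_graphs_on_iff[OF V])
  have T_count: "fact (card V) * card (iso_classes ?T) = (\<Sum>T\<in>?T. card (stabilizer V T))"
    by (rule card_iso_classes[OF V])
      (simp_all add: relabel_tournaments_on[OF V], simp add: mem_tournaments_on_iff[OF V])
  have stab: "stabilizer V Y = {g \<in> ?P. relabel g Y = Y}" for Y
    by (auto simp: stabilizer_def)
  \<comment> \<open>The sum over a stabilizer is the same for every tournament, so the factor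
    \<open>card ?T\<close> can be spent on a summation over tournaments.\<close>
  have "int (card ?T) * (\<Sum>X\<in>E. int (card (stabilizer V X))) =
      (\<Sum>T\<in>?T. \<Sum>X\<in>?G. if even_graph X then int (card (stabilizer V X)) else 0)"
    by (simp add: E sum.inter_filter)
  also have "\<dots> = (\<Sum>T\<in>?T. \<Sum>X\<in>?G. \<Sum>g\<in>stabilizer V X. reversal_sign X T g)"
    by (intro sum.cong refl) (simp only: sum_reversal_sign_stabilizer[OF V])
  also have "\<dots> = (\<Sum>X\<in>?G. \<Sum>g\<in>stabilizer V X. \<Sum>T\<in>?T. reversal_sign X T g)"
    by (subst sum.swap, intro sum.cong refl, rule sum.swap)
  \<comment> \<open>Permutations that do not fix \<open>X\<close> contribute 0. Including them makes
    the range of \<open>g\<close> independent of \<open>X\<close>, so the sum over graphs can be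
    moved inside.\<close>
  also have "\<dots> = (\<Sum>X\<in>?G. \<Sum>g\<in>?P. \<Sum>T\<in>?T. reversal_sign X T g)"
    by (intro sum.cong refl sum.mono_neutral_left)
      (auto simp: stab sum_reversal_sign_tournaments[OF V])
  also have "\<dots> = (\<Sum>T\<in>?T. \<Sum>g\<in>?P. \<Sum>X\<in>?G. reversal_sign X T g)"
    by (subst sum.swap, subst (2) sum.swap, subst sum.swap, rule refl)
  also have "\<dots> = (\<Sum>T\<in>?T. \<Sum>g\<in>?P. if relabel g T = T then int (card ?G) else 0)"
    by (intro sum.cong refl) (simp add: sum_reversal_sign_graphs[OF V])
  also have "\<dots> = int (card ?G) * (\<Sum>T\<in>?T. int (card (stabilizer V T)))"
    by (simp add: stab sum_distrib_left mult.commute flip: sum.inter_filter)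
  \<comment> \<open>The equal factors \<open>card ?T\<close> and \<open>card ?G\<close>
    cancel.\<close>
  finally have "(\<Sum>X\<in>E. card (stabilizer V X)) = (\<Sum>T\<in>?T. card (stabilizer V T))"
    using pos T by (auto simp: card_graphs_on_eq_card_tournaments_on[OF V] simp flip: of_nat_sum)
  then have "card (iso_classes E) = card (iso_classes ?T)"
    unfolding E_count[symmetric] T_count[symmetric] by simp
  then show ?thesis unfolding E_def tournaments_on_def .
qed

theorem theorem1p1:
  fixes n :: nat
  assumes "n \<ge> 2"
  shows "card (iso_classes {X :: nat pair_pre_digraph. even_graph X \<and> pverts X = {1..n}}) =
         card (iso_classes {T :: nat pair_pre_digraph. tournament T \<and> pverts T = {1..n}})"
  by (rule card_iso_classes_even_graphs_eq_tournaments) simp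

end
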